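(* For every wheel-graph instance (any $n\ge4$ and $\mu\in(0,1)$), the optimal value of the relaxed master problem RMP augmented with any collection of fewer than $n$ partial-route-based inequalities (as listed in the context) is strictly less than $Z^*$, the optimal value of the VRPSD instance under the optimal restocking policy.
   Context: **Wheel-graph instance.** Customers $N=\{1,\dots,n\}$, $n\ge4$, depot $0$. Let $E_1=\{\{k,k+1\}:1\le k\le n-1\}\cup\{\{n,1\}\}$ and $E_2=E(N)\setminus E_1$, where $E(N)$ denotes all edges between customers. Costs: $c_{0,i}=1$; $c_{i,j}=1$ if $\{i,j\}\in E_1$, $c_{i,j}=2$ if $\{i,j\}\in E_2$. Demands $\xi_i\sim\text{Bern}(\mu)$ are independent, $\mu\in(0,1)$. Capacity $Q=n-1$. Exactly one route is used ($M=\{1\}$), with load factor $f\ge n\mu/Q$, so feasible solutions $x$ are exactly the edge-multiplicity vectors of routes $(0,p,0)$ with $p$ a permutation of $N$. Penalties $b^F=b^P=0$: failure cost $c^F_i=2$, preventive return cost $c^P_{i,j}=2-c_{i,j}$ for customers $i\neq j$, and $c^P_{0,j}=0$. **OR recourse.** Let $\Psi(s,q)=\max\{\lceil(s-q)/Q\rceil,0\}$. For a path (nonempty sequence of distinct customers) $p=(i_1,\dots,i_t)$ with customer set $N(p)$, $i_0=0$, $q\in\{0,\dots,Q\}$: $F^p_{i_t}(q)=0$ and for $j<t$, $F^p_{i_j}(q)=\min\{H^p_{i_{j+1}}(q),c^P_{i_j,i_{j+1}}+H^p_{i_{j+1}}(Q)\}$ with $H^p_{i}(q)=\mathbb{E}[c^F_i\Psi(\xi_i,q)+F^p_i(\Psi(\xi_i,q)Q+q-\xi_i)]$.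 $\mathcal{Q}^{\text{OR}}_p$ is the minimum of $F^p_{i_0}(Q)$ over $p$ and its reversal. $Z^*$ is the minimum over feasible $x$, with route $(0,p,0)$, of $\sum_ec_ex_e+\mathcal{Q}^{\text{OR}}_p$. **RMP.** Minimize $\sum_ec_ex_e+\sum_{i\in N}\theta_i$ over feasible (integer) $x$ and $\theta\in\mathbb{R}^N_{\ge0}$. **Partial routes.** A partial route is a sequence $h=(U_0,U_1,\dots,U_b)$, $b\ge2$, with $U_0=U_b=\{0\}$, $U_1,\dots,U_{b-1}$ nonempty pairwise disjoint subsets of $N$, such that at least one of any two consecutive sets is a singleton. $N(h)=\bigcup_{j=1}^{b-1}U_j$. A route $(0,p,0)$ with $N(p)=N(h)$ adheres to $h$ if it visits all customers of $U_1$ (in any order), then all of $U_2$, and so on. $R_h$ is the set of routes adhering to $h$ in at least one of their two orientations. $W_h$ is any activation function: $W_h(x)=1$ at every feasible $x$ whose route is in $R_h$ and $W_h(x)\le0$ at all other feasible $x$. $P_h\ge0$ is any number with $P_h\le\mathcal{Q}^{\text{OR}}_p$ for all $(0,p,0)\in R_h$. **Partial-route-based inequalities.** In this single-route setting (where some feasible solution has zero recourse cost) these are: (a) the partial route-split inequalities $\theta_{v(h)}\ge P_hW_h(x)$, with $v(h)$ the lowest-indexed customer of $N(h)$ (route-split inequalities are the case where all $U_j$ are singletons); (b) the partial route and multi-route-split inequalities, which take the form $\sum_{i\in N}\theta_i\ge P_hW_h(x)$ with $N(h)=N$; (c) inequalities that are inactive, i.e., satisfied by $(x,\theta)$ for every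 feasible $x$ and every $\theta\geq 0$ (partial route inequalities with $N(h)\ne N$, and multi-route-split inequalities for customer sets $S\neq N$). *)

theory Defs
  imports "HOL-Probability.Probability" "HOL-Probability.Product_PMF"
begin

section \<open>The wheel-graph instance\<close>

definition customers :: "nat \<Rightarrow> nat set" where
  "customers n = {1..n}"

definition edges_on :: "nat set \<Rightarrow> nat set set" where
  "edges_on V = {{i, j} | i j. i \<in> V \<and> j \<in> V \<and> i \<noteq> j}"

definition E1 :: "nat \<Rightarrow> nat set set" where
  "E1 n = {{k, k + 1} | k. 1 \<le> k \<and> k \<le> n - 1} \<union> {{n, 1}}"

definition E2 :: "nat \<Rightarrow> nat set set" where
  "E2 n = edges_on (customers n) - E1 n"

definition edge_cost :: "nat \<Rightarrow> nat set \<Rightarrow> real" where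
  "edge_cost n e = (if e \<in> E2 n then 2 else 1)"

definition capacity :: "nat \<Rightarrow> int" where
  "capacity n = int n - 1"

text \<open>Joint law of the independent Bernoulli demands; \<open>0\<close> is the default value off the customers.\<close>

definition demand_law :: "nat \<Rightarrow> real \<Rightarrow> (nat \<Rightarrow> int) pmf" where
  "demand_law n \<mu> = Pi_pmf (customers n) 0 (\<lambda>_. map_pmf of_bool (bernoulli_pmf \<mu>))"

definition failure_cost :: "nat \<Rightarrow> real" where
  "failure_cost i = 2"

definition preventive_cost :: "nat \<Rightarrow> nat \<Rightarrow> nat \<Rightarrow> real" where
  "preventive_cost n i j = (if i = 0 then 0 else 2 - edge_cost n {i, j})"


section \<open>Routes and feasible solutions\<close>

text \<open>A route \<open>(0, p, 0)\<close> is represented by the list \<open>p\<close> of its customers.\<close>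

definition cust_path :: "nat \<Rightarrow> nat list \<Rightarrow> bool" where
  "cust_path n p \<longleftrightarrow> p \<noteq> [] \<and> distinct p \<and> set p \<subseteq> customers n"

text \<open>
  With a single vehicle, a feasible route visits every customer exactly once, and its expected
  load must not exceed \<open>f\<close> times the capacity.
\<close>

definition feasible_routes :: "nat \<Rightarrow> real \<Rightarrow> real \<Rightarrow> nat list set" where
  "feasible_routes n \<mu> f =
     {p. distinct p \<and> set p = customers n \<and> (\<Sum>i\<in>set p. \<mu>) \<le> f * of_int (capacity n)}"

definition edge_vec :: "nat list \<Rightarrow> nat set \<Rightarrow> nat" where
  "edge_vec p e = (let r = 0 # p @ [0] in card {k. k + 1 < length r \<and> {r ! k, r ! (k + 1)} = e})"

definition feasible :: "nat \<Rightarrow> real \<Rightarrow> real \<Rightarrow> (nat set \<Rightarrow> nat) set" where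
  "feasible n \<mu> f = edge_vec ` feasible_routes n \<mu> f"

lemma feasible_routes_eq:
  assumes "n \<ge> 2" and "f \<ge> real n * \<mu> / of_int (capacity n)"
  shows "feasible_routes n \<mu> f = {p. distinct p \<and> set p = customers n}"
  using assms by (auto simp: feasible_routes_def capacity_def customers_def field_simps)

definition routing_cost :: "nat \<Rightarrow> (nat set \<Rightarrow> nat) \<Rightarrow> real" where
  "routing_cost n x = (\<Sum>e\<in>edges_on (insert 0 (customers n)). edge_cost n e * real (x e))"


section \<open>Recourse cost under optimal restocking\<close>

definition \<Psi> :: "nat \<Rightarrow> int \<Rightarrow> int \<Rightarrow> int" where
  "\<Psi> n s q = max \<lceil>real_of_int (s - q) / real_of_int (capacity n)\<rceil> 0"

text \<open>
  \<open>cost_F n \<mu> i js q\<close> is the expected cost-to-go when leaving location \<open>i\<close> with residual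
  capacity \<open>q\<close> and the customers \<open>js\<close> still ahead; \<open>cost_H n \<mu> i js q\<close> is the one upon arrival
  at \<open>i\<close>, before its demand is revealed.
\<close>

fun cost_F :: "nat \<Rightarrow> real \<Rightarrow> nat \<Rightarrow> nat list \<Rightarrow> int \<Rightarrow> real"
  and cost_H :: "nat \<Rightarrow> real \<Rightarrow> nat \<Rightarrow> nat list \<Rightarrow> int \<Rightarrow> real" where
  "cost_F n \<mu> i [] q = 0"
| "cost_F n \<mu> i (j # js) q =
     min (cost_H n \<mu> j js q) (preventive_cost n i j + cost_H n \<mu> j js (capacity n))"
| "cost_H n \<mu> i js q =
     measure_pmf.expectation (demand_law n \<mu>)
       (\<lambda>\<xi>. failure_cost i * of_int (\<Psi> n (\<xi> i) q)
            + cost_F n \<mu> i js (\<Psi> n (\<xi> i) q * capacity n + q - \<xi> i))"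

definition OR_recourse :: "nat \<Rightarrow> real \<Rightarrow> nat list \<Rightarrow> real" where
  "OR_recourse n \<mu> p =
     min (cost_F n \<mu> 0 p (capacity n)) (cost_F n \<mu> 0 (rev p) (capacity n))"

definition Z_star :: "nat \<Rightarrow> real \<Rightarrow> real \<Rightarrow> real" where
  "Z_star n \<mu> f =
     Min ((\<lambda>p. routing_cost n (edge_vec p) + OR_recourse n \<mu> p) ` feasible_routes n \<mu> f)"


section \<open>Partial routes\<close>

text \<open>A sequence \<open>(U\<^sub>0, \<dots>, U\<^sub>b)\<close> is a list of length \<open>b + 1\<close>, depot sets included.\<close>

definition partial_route :: "nat \<Rightarrow> nat set list \<Rightarrow> bool" where
  "partial_route n h \<longleftrightarrow> (let b = length h - 1 in
     b \<ge> 2 \<and> h ! 0 = {0} \<and> h ! b = {0} \<and>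
     (\<forall>j\<in>{1..b - 1}. h ! j \<noteq> {} \<and> h ! j \<subseteq> customers n) \<and>
     (\<forall>j\<in>{1..b - 1}. \<forall>k\<in>{1..b - 1}. j \<noteq> k \<longrightarrow> h ! j \<inter> h ! k = {}) \<and>
     (\<forall>j<b. is_singleton (h ! j) \<or> is_singleton (h ! (j + 1))))"

definition pr_customers :: "nat set list \<Rightarrow> nat set" where
  "pr_customers h = (\<Union>j\<in>{1..length h - 2}. h ! j)"

text \<open>
  Adherence: \<open>p\<close> splits into consecutive blocks, the \<open>j\<close>-th of which enumerates \<open>U\<^sub>j\<close>
  (\<open>butlast (tl h)\<close> removes the two depot sets).
\<close>

definition adheres :: "nat set list \<Rightarrow> nat list \<Rightarrow> bool" where
  "adheres h p \<longleftrightarrow> set p = pr_customers h \<and>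
     (\<exists>bs. p = concat bs \<and> map set bs = butlast (tl h))"

definition R :: "nat \<Rightarrow> nat set list \<Rightarrow> nat list set" where
  "R n h = {p. cust_path n p \<and> (adheres h p \<or> adheres h (rev p))}"

definition activation :: "nat \<Rightarrow> real \<Rightarrow> real \<Rightarrow> nat set list \<Rightarrow> ((nat set \<Rightarrow> nat) \<Rightarrow> real) \<Rightarrow> bool" where
  "activation n \<mu> f h W \<longleftrightarrow> (\<forall>p\<in>feasible_routes n \<mu> f.
     (p \<in> R n h \<longrightarrow> W (edge_vec p) = 1) \<and> (p \<notin> R n h \<longrightarrow> W (edge_vec p) \<le> 0))"

definition recourse_bound :: "nat \<Rightarrow> real \<Rightarrow> nat set list \<Rightarrow> real \<Rightarrow> bool" where
  "recourse_bound n \<mu> h P \<longleftrightarrow> P \<ge> 0 \<and> (\<forall>p\<in>R n h. P \<le> OR_recourse n \<mu> p)"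


section \<open>Partial-route-based inequalities and the relaxed master problem\<close>

text \<open>The vectors in \<open>\<real>\<^sup>N\<close> with nonnegative entries.\<close>

definition thetas :: "nat \<Rightarrow> (nat \<Rightarrow> real) set" where
  "thetas n = customers n \<rightarrow>\<^sub>E {0..}"

text \<open>An inequality is identified with the predicate on \<open>(x, \<theta>)\<close> that it defines.\<close>

type_synonym ineq = "(nat set \<Rightarrow> nat) \<Rightarrow> (nat \<Rightarrow> real) \<Rightarrow> bool"

inductive partial_route_based :: "nat \<Rightarrow> real \<Rightarrow> real \<Rightarrow> ineq \<Rightarrow> bool"
  for n :: nat and \<mu> f :: real where
  partial_route_split:
    "\<lbrakk>partial_route n h; activation n \<mu> f h W; recourse_bound n \<mu> h P\<rbrakk>
     \<Longrightarrow> partial_route_based n \<mu> f (\<lambda>x \<theta>. \<theta> (Min (pr_customers h)) \<ge> P * W x)"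
| all_customers:
    "\<lbrakk>partial_route n h; pr_customers h = customers n;
      activation n \<mu> f h W; recourse_bound n \<mu> h P\<rbrakk>
     \<Longrightarrow> partial_route_based n \<mu> f (\<lambda>x \<theta>. (\<Sum>i\<in>customers n. \<theta> i) \<ge> P * W x)"
| inactive:
    "(\<And>x \<theta>. x \<in> feasible n \<mu> f \<Longrightarrow> \<theta> \<in> thetas n \<Longrightarrow> I x \<theta>)
     \<Longrightarrow> partial_route_based n \<mu> f I"

definition RMP_objectives :: "nat \<Rightarrow> real \<Rightarrow> real \<Rightarrow> ineq set \<Rightarrow> real set" where
  "RMP_objectives n \<mu> f C =
     {routing_cost n x + (\<Sum>i\<in>customers n. \<theta> i) | x \<theta>.
        x \<in> feasible n \<mu> f \<and> \<theta> \<in> thetas n \<and> (\<forall>I\<in>C. I x \<theta>)}"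

definition RMP_value :: "nat \<Rightarrow> real \<Rightarrow> real \<Rightarrow> ineq set \<Rightarrow> real" where
  "RMP_value n \<mu> f C = Inf (RMP_objectives n \<mu> f C)"

lemma bdd_below_RMP_objectives: "bdd_below (RMP_objectives n \<mu> f C)"
proof (rule bdd_belowI[of _ 0])
  fix v assume "v \<in> RMP_objectives n \<mu> f C"
  then obtain x \<theta> where v: "v = routing_cost n x + (\<Sum>i\<in>customers n. \<theta> i)"
    and \<theta>: "\<theta> \<in> thetas n" by (auto simp: RMP_objectives_def)
  have "routing_cost n x \<ge> 0"
    by (auto simp: routing_cost_def edge_cost_def intro!: sum_nonneg)
  moreover have "(\<Sum>i\<in>customers n. \<theta> i) \<ge> 0"
    using \<theta> by (intro sum_nonneg) (auto simp: thetas_def PiE_iff)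
  ultimately show "v \<ge> 0" using v by simp
qed

end

theory Submission
  imports Defs
begin

text \<open>
  The total demand exceeds the capacity only if all \<open>n\<close> demands are \<open>1\<close>. A route that uses an edge
  of \<open>E2\<close> restocks there for free, so its recourse cost is \<open>0\<close>, but its routing cost is at least
  \<open>n + 2\<close>. A route along the rim costs \<open>n + 1\<close> and has positive recourse cost; hence \<open>Z_star > n + 1\<close>.
  There are \<open>n\<close> rim routes up to reversal, and an inequality with \<open>P > 0\<close> cuts off at most one of
  them at \<open>\<theta> = 0\<close>: if a set of the partial route has two elements, exchanging two neighbours of an
  adhering rim route inside that set gives an adhering route with an edge of \<open>E2\<close>, which forces
  \<open>P = 0\<close>. So fewer than \<open>n\<close> inequalities leave some rim route with objective value \<open>n + 1\<close>.
\<close>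

section \<open>Recourse costs\<close>

lemma zero_notin_customers: "0 \<notin> customers n"
  by (simp add: customers_def)

lemma doubleton_in_edges_on_iff: "{i, j} \<in> edges_on V \<longleftrightarrow> i \<in> V \<and> j \<in> V \<and> i \<noteq> j"
  by (auto simp: edges_on_def doubleton_eq_iff)

declare cost_H.simps [simp del]

text \<open>As \<open>\<mu>\<close> lies strictly between 0 and 1, every 0/1 vector on the customers
  is a possible demand. The support is finite, so everything is integrable, and the expectation of a
  nonnegative function is positive as soon as one such vector contributes.\<close>

lemma set_demand_law:
  assumes "0 < \<mu>" "\<mu> < 1"
  shows "set_pmf (demand_law n \<mu>) = PiE_dflt (customers n) 0 (\<lambda>_. {0, 1})"
proof -
  have "range (of_bool :: bool \<Rightarrow> int) = {0, 1}"
    by (auto simp: image_def of_bool_def)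
  then show ?thesis
    using assms by (simp add: demand_law_def set_Pi_pmf customers_def comp_def set_pmf_bernoulli)
qed

lemma integrable_demand_law:
  fixes g :: "(nat \<Rightarrow> int) \<Rightarrow> real"
  assumes "0 < \<mu>" "\<mu> < 1"
  shows "integrable (measure_pmf (demand_law n \<mu>)) g"
  by (intro integrable_measure_pmf_finite)
     (auto simp: set_demand_law[OF assms] customers_def intro!: finite_PiE_dflt)

lemma demand_cases:
  assumes "0 < \<mu>" "\<mu> < 1" "\<xi> \<in> set_pmf (demand_law n \<mu>)"
  shows "\<xi> i = 0 \<or> \<xi> i = 1"
  using assms(3) by (auto simp: set_demand_law[OF assms(1,2)] PiE_dflt_def)

lemma Psi_nonneg: "\<Psi> n s q \<ge> 0"
  by (simp add: \<Psi>_def)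

lemma Psi_eq_0:
  assumes "n \<ge> 2" "s \<le> q"
  shows "\<Psi> n s q = 0"
proof -
  have "real_of_int (s - q) / real_of_int (capacity n) \<le> 0"
    using assms by (intro divide_nonpos_nonneg) (auto simp: capacity_def)
  then show ?thesis by (simp add: \<Psi>_def ceiling_le_iff)
qed

lemma Psi_pos:
  assumes "n \<ge> 2" "s > q"
  shows "\<Psi> n s q \<ge> 1"
proof -
  have "real_of_int (s - q) / real_of_int (capacity n) > 0"
    using assms by (auto simp: capacity_def intro!: divide_pos_pos)
  then show ?thesis by (simp add: \<Psi>_def)
qed

section \<open>Nonnegativity and vanishing of the recourse costs\<close>

lemma preventive_cost_nonneg: "preventive_cost n i j \<ge> 0"
  by (simp add: preventive_cost_def edge_cost_def)

lemma cost_nonneg: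
  "cost_F n \<mu> i js q \<ge> 0"
  "cost_H n \<mu> i js q \<ge> 0"
proof (induction n \<mu> i js q and n \<mu> i js q rule: cost_F_cost_H.induct)
  case (2 n \<mu> i j js q)
  then show ?case
    using preventive_cost_nonneg by (simp add: min_def)
next
  case (3 n \<mu> i js q)
  then show ?case
    by (auto simp: cost_H.simps failure_cost_def Psi_nonneg intro!: integral_nonneg add_nonneg_nonneg)
qed simp

text \<open>A demand is at most 1, hence at most \<open>q\<close>: no failure occurs and the vehicle
  leaves with \<open>q\<close> or \<open>q - 1\<close>, the two residuals assumed to be
  free.\<close>

lemma cost_H_eq_0:
  assumes "n \<ge> 2" "0 < \<mu>" "\<mu> < 1" "q \<ge> 1"
    and "cost_F n \<mu> i js q = 0" "cost_F n \<mu> i js (q - 1) = 0"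
  shows "cost_H n \<mu> i js q = 0"
proof -
  have "failure_cost i * of_int (\<Psi> n (\<xi> i) q)
          + cost_F n \<mu> i js (\<Psi> n (\<xi> i) q * capacity n + q - \<xi> i) = 0"
    if "\<xi> \<in> set_pmf (demand_law n \<mu>)" for \<xi>
    using demand_cases[OF assms(2,3) that, of i] assms(4-) Psi_eq_0[OF assms(1), of "\<xi> i" q]
    by auto
  then show ?thesis
    by (auto intro!: integral_eq_zero_AE simp: cost_H.simps AE_measure_pmf_iff)
qed

lemma cost_F_eq_0_if_cost_H:
  assumes "cost_H n \<mu> j js q = 0"
  shows "cost_F n \<mu> i (j # js) q = 0"
  using assms cost_nonneg[of n \<mu>] preventive_cost_nonneg[of n i j]
  by (simp add: min_def)

text \<open>Each customer ahead takes at most one unit, so a load of one unit per customer never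
  runs out.\<close>

lemma cost_F_eq_0_if_capacity:
  assumes "n \<ge> 2" "0 < \<mu>" "\<mu> < 1" "q \<ge> int (length js)"
  shows "cost_F n \<mu> i js q = 0"
  using assms(4)
proof (induction js arbitrary: i q)
  case (Cons j js)
  then show ?case
    by (intro cost_F_eq_0_if_cost_H cost_H_eq_0 assms(1-3)) auto
qed simp

text \<open>The load lasts through \<open>as\<close> and \<open>x\<close>. Between \<open>x\<close>
  and \<open>y\<close> the preventive return costs \<open>2 - 2 = 0\<close> and restores the full
  capacity, which lasts through \<open>y\<close> and \<open>bs\<close>.\<close>

lemma cost_F_eq_0_if_E2:
  assumes "n \<ge> 2" "0 < \<mu>" "\<mu> < 1" "{x, y} \<in> E2 n"
    and "q \<ge> int (length as) + 1" "capacity n \<ge> int (length bs) + 1"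
  shows "cost_F n \<mu> i (as @ x # y # bs) q = 0"
  using assms(5)
proof (induction as arbitrary: i q)
  case Nil
  have "x \<noteq> 0"
    using assms(4) zero_notin_customers[of n] by (metis DiffD1 E2_def doubleton_in_edges_on_iff)
  moreover have "cost_H n \<mu> y bs (capacity n) = 0"
    using assms by (intro cost_H_eq_0 cost_F_eq_0_if_capacity) auto
  \<comment> \<open>Arbitrary \<open>q'\<close> is wanted because \<open>x\<close> may be left with
    \<open>q\<close> or \<open>q - 1\<close>, possibly 0; the return is free from any level.\<close>
  ultimately have F: "cost_F n \<mu> x (y # bs) q' = 0" for q'
    using assms(4) cost_nonneg(2)[of n \<mu> y bs q']
    by (simp add: preventive_cost_def edge_cost_def min_def)
  then show ?case
    using Nil
    by (simp only: append_Nil) (intro cost_F_eq_0_if_cost_H cost_H_eq_0 assms(1-3) F, simp)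
next
  case (Cons a as)
  then show ?case
    by (simp only: append_Cons) (intro cost_F_eq_0_if_cost_H cost_H_eq_0 assms(1-3), auto)
qed

lemma OR_recourse_nonneg: "OR_recourse n \<mu> p \<ge> 0"
  by (simp add: OR_recourse_def cost_nonneg)

lemma length_route:
  assumes "distinct p" "set p = customers n"
  shows "length p = n"
  using distinct_card[OF assms(1)] assms(2) by (simp add: customers_def)

text \<open>Counting gives \<open>capacity n = length as + length bs + 1\<close>, enough for both
  stretches. One orientation of cost 0 settles the minimum.\<close>

lemma OR_recourse_eq_0_if_E2:
  assumes "n \<ge> 2" "0 < \<mu>" "\<mu> < 1" "distinct p" "set p = customers n"
    and "p = as @ x # y # bs" "{x, y} \<in> E2 n"
  shows "OR_recourse n \<mu> p = 0"
proof -
  have "length as + length bs + 2 = n"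
    using length_route[OF assms(4,5)] assms(6) by simp
  then have "cost_F n \<mu> 0 p (capacity n) = 0"
    unfolding assms(6) using assms(1-3,7) by (intro cost_F_eq_0_if_E2) (auto simp: capacity_def)
  then show ?thesis
    using cost_nonneg(1)[of n \<mu> 0 "rev p"] by (simp add: OR_recourse_def)
qed

section \<open>Positivity of the recourse cost along the rim\<close>

lemma cost_H_pos_if_demand_1:
  assumes "0 < \<mu>" "\<mu> < 1" "j \<in> customers n"
    and "failure_cost j * of_int (\<Psi> n 1 q)
           + cost_F n \<mu> j js (\<Psi> n 1 q * capacity n + q - 1) > 0"
  shows "cost_H n \<mu> j js q > 0"
proof -
  define g where "g = (\<lambda>\<xi>. failure_cost j * of_int (\<Psi> n (\<xi> j) q)
    + cost_F n \<mu> j js (\<Psi> n (\<xi> j) q * capacity n + q - \<xi> j))"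
  have H: "cost_H n \<mu> j js q = measure_pmf.expectation (demand_law n \<mu>) g"
    by (simp add: g_def cost_H.simps)
  have "g \<xi> \<ge> 0" for \<xi>
    by (simp add: g_def failure_cost_def Psi_nonneg cost_nonneg)
  \<comment> \<open>In the witness only \<open>j\<close> has demand 1; off the customers it takes
    the default value 0, as the support requires.\<close>
  moreover have "(\<lambda>i. of_bool (i = j)) \<in> set_pmf (demand_law n \<mu>)"
    using assms(3) by (auto simp: set_demand_law[OF assms(1,2)] PiE_dflt_def)
  moreover have "g (\<lambda>i. of_bool (i = j)) \<noteq> 0"
    using assms(4) by (simp add: g_def)
  ultimately have "measure_pmf.expectation (demand_law n \<mu>) g \<noteq> 0"
    by (subst integral_nonneg_eq_0_iff_AE)
       (auto simp: integrable_demand_law[OF assms(1,2)] AE_measure_pmf_iff)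
  then show ?thesis
    using cost_nonneg(2)[of n \<mu> j js q] H by linarith
qed

text \<open>The residual capacity is one less than the number of customers still to be served.\<close>

lemma cost_H_pos:
  assumes "n \<ge> 2" "0 < \<mu>" "\<mu> < 1"
    and "successively (\<lambda>i j. {i, j} \<notin> E2 n) (j # js)" "set (j # js) \<subseteq> customers n"
  shows "cost_H n \<mu> j js (int (length js)) > 0"
  using assms(4,5)
proof (induction js arbitrary: j)
  case (Cons k ks)
  have "j \<noteq> 0"
    using Cons.prems(2) zero_notin_customers[of n] by (metis list.set_intros(1) subsetD)
  moreover have "{j, k} \<notin> E2 n"
    using Cons.prems by simp
  \<comment> \<open>After a demand of 1 at \<open>j\<close> both options are positive: driving on by
    the induction hypothesis, and returning because \<open>{j, k}\<close> costs 1, which makes the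
    return cost \<open>2 - 1\<close>.\<close>
  ultimately have "cost_F n \<mu> j (k # ks) (int (length ks)) > 0"
    using Cons.IH[of k] Cons.prems cost_nonneg(2)[of n \<mu> k ks "capacity n"]
    by (simp add: preventive_cost_def edge_cost_def)
  then show ?case
    using Cons.prems Psi_eq_0[OF assms(1), of 1 "int (length (k # ks))"]
    by (intro cost_H_pos_if_demand_1 assms(2,3)) (auto simp del: cost_F.simps)
next
  case Nil
  \<comment> \<open>At the last customer the residual is 0, so a demand of 1 is a failure.\<close>
  then show ?case
    using Psi_pos[OF assms(1), of 0 1]
    by (intro cost_H_pos_if_demand_1 assms(2,3)) (auto simp: failure_cost_def)
qed

text \<open>The vehicle starts with \<open>n - 1\<close> units for \<open>n\<close> customers. At
  the depot it is already full and a return costs 0, so both options of the first minimum equal the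
  same positive \<open>cost_H\<close>.\<close>

lemma cost_F_pos_if_no_E2:
  assumes "n \<ge> 2" "0 < \<mu>" "\<mu> < 1" "distinct p" "set p = customers n"
    and "successively (\<lambda>i j. {i, j} \<notin> E2 n) p"
  shows "cost_F n \<mu> 0 p (capacity n) > 0"
proof (cases p)
  case Nil
  then show ?thesis using length_route[OF assms(4,5)] assms(1) by simp
next
  case (Cons j js)
  then have "capacity n = int (length js)"
    using length_route[OF assms(4,5)] by (auto simp: capacity_def)
  moreover have "cost_H n \<mu> j js (int (length js)) > 0"
    using cost_H_pos[OF assms(1-3), of j js] assms(5,6) Cons by blast
  ultimately show ?thesis
    using Cons
    by (simp add: preventive_cost_def)
qed

lemma OR_recourse_pos_if_no_E2:
  assumes "n \<ge> 2" "0 < \<mu>" "\<mu> < 1" "distinct p" "set p = customers n"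
    and "successively (\<lambda>i j. {i, j} \<notin> E2 n) p"
  shows "OR_recourse n \<mu> p > 0"
  using cost_F_pos_if_no_E2[OF assms] cost_F_pos_if_no_E2[OF assms(1-3), of "rev p"] assms(4-6)
  by (simp add: OR_recourse_def successively_rev insert_commute)


section \<open>Routing costs\<close>

text \<open>Double counting: the \<open>n + 1\<close> steps of the closed walk \<open>r\<close> are
  grouped by their edge. Consecutive entries of \<open>r\<close> differ, so every step is a genuine
  edge and is counted.\<close>

lemma routing_cost_edge_vec:
  assumes "distinct p" "set p = customers n" "n \<ge> 2"
  defines "r \<equiv> 0 # p @ [0]"
  shows "routing_cost n (edge_vec p) = (\<Sum>k\<le>n. edge_cost n {r ! k, r ! (k + 1)})"
proof -
  define E where "E = edges_on (insert 0 (customers n))"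
  define g where "g k = {r ! k, r ! (k + 1)}" for k
  have len: "length p = n" by (rule length_route[OF assms(1,2)])
  have "E \<subseteq> Pow (insert 0 (customers n))"
    by (auto simp: E_def edges_on_def)
  then have fin: "finite E"
    by (rule finite_subset) (simp add: customers_def)
  have "r ! k \<noteq> r ! (k + 1)" if "k \<le> n" for k
  proof (cases "k = 0 \<or> k = n")
    case True
    have "p ! i \<noteq> 0" if "i < n" for i
      using that len assms(2) zero_notin_customers[of n] nth_mem[of i p] by metis
    from this[of 0] this[of "n - 1"] have "p ! 0 \<noteq> 0" "p ! (n - 1) \<noteq> 0"
      using assms(3) by auto
    then show ?thesis
      using True len assms(3) by (auto simp: r_def nth_append nth_Cons')
  next
    case False
    then show ?thesis
      using that len assms(1) by (auto simp: r_def nth_append nth_Cons' nth_eq_iff_index_eq)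
  qed
  moreover have "r ! k \<in> insert 0 (customers n)" if "k \<le> n + 1" for k
  proof -
    have "r ! k \<in> set r" using that len by (intro nth_mem) (simp add: r_def)
    then show ?thesis using assms(2) by (auto simp: r_def)
  qed
  ultimately have "g ` {..n} \<subseteq> E"
    by (auto simp: E_def g_def doubleton_in_edges_on_iff)
  have "routing_cost n (edge_vec p) = (\<Sum>e\<in>E. edge_cost n e * real (card {k \<in> {..n}. g k = e}))"
    unfolding routing_cost_def edge_vec_def Let_def E_def g_def r_def
    by (intro sum.cong refl arg_cong2[of _ _ _ _ "(*)"] arg_cong[of _ _ real] arg_cong[of _ _ card])
       (auto simp: len)
  also have "\<dots> = (\<Sum>e\<in>E. \<Sum>k\<in>{k \<in> {..n}. g k = e}. edge_cost n (g k))"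
    by (intro sum.cong refl) (simp add: mult.commute)
  also have "\<dots> = (\<Sum>k\<le>n. edge_cost n (g k))"
    using fin \<open>g ` {..n} \<subseteq> E\<close> by (intro sum.group) auto
  finally show ?thesis by (simp add: g_def)
qed

lemma routing_cost_ge:
  assumes "distinct p" "set p = customers n" "n \<ge> 2"
  shows "routing_cost n (edge_vec p) \<ge> n + 1"
proof -
  have "(\<Sum>k\<le>n. 1) \<le> routing_cost n (edge_vec p)"
    unfolding routing_cost_edge_vec[OF assms] by (intro sum_mono) (simp add: edge_cost_def)
  then show ?thesis by simp
qed

lemma routing_cost_ge_if_E2:
  assumes "distinct p" "set p = customers n" "n \<ge> 2"
    and "\<not> successively (\<lambda>i j. {i, j} \<notin> E2 n) p"
  shows "routing_cost n (edge_vec p) \<ge> n + 2"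
proof -
  define r where "r = 0 # p @ [0]"
  obtain i where i: "Suc i < length p" "{p ! i, p ! Suc i} \<in> E2 n"
    using assms(4) by (auto simp: successively_conv_nth)
  have len: "length p = n" by (rule length_route[OF assms(1,2)])
  \<comment> \<open>The depot in front shifts position \<open>i\<close> of \<open>p\<close> to
    \<open>Suc i\<close> of \<open>r\<close>; that step costs 2, all others at least 1.\<close>
  have "(\<Sum>k\<le>n. 1 + of_bool (k = Suc i)) \<le> (\<Sum>k\<le>n. edge_cost n {r ! k, r ! (k + 1)})"
    using i by (intro sum_mono) (auto simp: edge_cost_def r_def nth_append)
  moreover have "(\<Sum>k\<le>n. 1 + of_bool (k = Suc i)) = real n + 2"
    using i len by (simp add: sum.distrib of_bool_def)
  ultimately show ?thesis
    unfolding routing_cost_edge_vec[OF assms(1-3)] r_def by simp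
qed

lemma routing_cost_no_E2:
  assumes "distinct p" "set p = customers n" "n \<ge> 2"
    and "successively (\<lambda>i j. {i, j} \<notin> E2 n) p"
  shows "routing_cost n (edge_vec p) = n + 1"
proof -
  define r where "r = 0 # p @ [0]"
  have len: "length p = n" by (rule length_route[OF assms(1,2)])
  have dep: "{0, i} \<notin> E2 n" "{i, 0} \<notin> E2 n" for i
    using zero_notin_customers[of n] by (auto simp: E2_def doubleton_in_edges_on_iff)
  have "{r ! k, r ! (k + 1)} \<notin> E2 n" if "k \<le> n" for k
  proof (cases "k = 0 \<or> k = n")
    case True
    then show ?thesis using dep len assms(3) by (auto simp: r_def nth_append)
  next
    case False
    then obtain i where "k = Suc i" "Suc i < length p"
      using \<open>k \<le> n\<close> len by (cases k) auto
    then show ?thesis using assms(4) by (auto simp: successively_conv_nth r_def nth_append)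
  qed
  then have "(\<Sum>k\<le>n. edge_cost n {r ! k, r ! (k + 1)}) = (\<Sum>k\<le>n. 1)"
    by (intro sum.cong) (auto simp: edge_cost_def)
  then show ?thesis
    unfolding routing_cost_edge_vec[OF assms(1-3)] r_def by simp
qed

lemma Z_star_gt:
  assumes "n \<ge> 2" "0 < \<mu>" "\<mu> < 1" "f \<ge> real n * \<mu> / of_int (capacity n)"
  shows "Z_star n \<mu> f > n + 1"
proof -
  have routes: "feasible_routes n \<mu> f = {p. distinct p \<and> set p = customers n}"
    by (rule feasible_routes_eq) (use assms in auto)
  have "finite (feasible_routes n \<mu> f)"
    unfolding routes
    by (rule finite_subset[OF _ finite_subset_distinct[of "customers n"]]) (auto simp: customers_def)
  moreover have "feasible_routes n \<mu> f \<noteq> {}"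
    using finite_distinct_list[of "customers n"] by (auto simp: routes customers_def)
  moreover have "routing_cost n (edge_vec p) + OR_recourse n \<mu> p > n + 1"
    if "p \<in> feasible_routes n \<mu> f" for p
  proof (cases "successively (\<lambda>i j. {i, j} \<notin> E2 n) p")
    case True
    then show ?thesis
      using that routing_cost_ge[of p n] OR_recourse_pos_if_no_E2[of n \<mu> p] assms
      by (simp add: routes)
  next
    case False
    then show ?thesis
      using that routing_cost_ge_if_E2[of p n] OR_recourse_nonneg[of n \<mu> p] assms
      by (simp add: routes)
  qed
  ultimately show ?thesis
    by (simp add: Z_star_def)
qed


section \<open>Rim routes\<close>

text \<open>The path along the rim that starts at customer \<open>k + 1\<close> in increasing cyclic
  order. The values \<open>k < n\<close> give one orientation of each rim route; the other is its
  \<open>rev\<close>.\<close>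

definition rim :: "nat \<Rightarrow> nat \<Rightarrow> nat list" where
  "rim n k = rotate k [1..<n + 1]"

lemma length_rim [simp]: "length (rim n k) = n"
  by (simp add: rim_def)

lemma distinct_rim [simp]: "distinct (rim n k)"
  by (simp add: rim_def)

lemma set_rim [simp]: "set (rim n k) = customers n"
  by (auto simp: rim_def customers_def)

lemma nth_rim: "i < n \<Longrightarrow> rim n k ! i = (k + i) mod n + 1"
  by (simp add: rim_def nth_rotate del: upt_Suc)

lemma rim_no_E2: "successively (\<lambda>i j. {i, j} \<notin> E2 n) (rim n k)"
proof -
  have "{rim n k ! i, rim n k ! Suc i} \<in> E1 n" if "Suc i < n" for i
  proof -
    define m where "m = (k + i) mod n"
    have "m < n" using that by (simp add: m_def)
    have "{m + 1, Suc m mod n + 1} \<in> E1 n"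
    proof (cases "Suc m = n")
      case True
      then show ?thesis by (auto simp: E1_def)
    next
      case False
      then have "Suc m < n" using \<open>m < n\<close> by simp
      then show ?thesis by (auto simp: E1_def intro!: exI[of _ "m + 1"])
    qed
    then show ?thesis
      using that by (simp add: nth_rim m_def mod_Suc_eq)
  qed
  then show ?thesis
    by (auto simp: successively_conv_nth E2_def)
qed

text \<open>On a cycle of length at least 4, two steps one way are never a single step the other
  way. For a triangle this fails.\<close>

lemma skip_in_E2:
  assumes "n \<ge> 4" "m < n"
  shows "{m + 1, (m + 2) mod n + 1} \<in> E2 n"
proof -
  consider "m + 2 < n" | "m + 2 = n" | "m + 1 = n" using assms by linarith
  then have "(m + 2) mod n + 1 = m + 3 \<and> m + 2 < n \<or> (m + 2) mod n + 1 = 1 \<and> m + 2 = n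
      \<or> (m + 2) mod n + 1 = 2 \<and> m + 1 = n"
  proof cases
    case 3
    then have "(m + 2) mod n = (1 + n) mod n" by (intro arg_cong2[of _ _ _ _ "(mod)"]) auto
    also have "\<dots> = 1" unfolding mod_add_self2 using assms by (intro mod_less) simp
    finally have "(m + 2) mod n = 1" .
    then show ?thesis using 3 by simp
  qed auto
  then show ?thesis
    using assms
    by (auto simp: E2_def E1_def customers_def doubleton_in_edges_on_iff doubleton_eq_iff simp del: One_nat_def)
qed

text \<open>Prepares the exchange argument: swapping \<open>x\<close> and \<open>y\<close> makes
  \<open>a\<close> and \<open>y\<close> neighbours. Reversal only turns the pattern around, and
  edges are unordered.\<close>

lemma rim_skip_in_E2:
  assumes "n \<ge> 4" "p = rim n k \<or> p = rev (rim n k)" "p = as @ a # x # y # cs"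
  shows "{a, y} \<in> E2 n"
proof -
  have *: "{a, y} \<in> E2 n" if p: "rim n k = as @ a # x # y # cs" for as a y cs
  proof -
    define i where "i = length as"
    have "length (rim n k) = length (as @ a # x # y # cs)" using p by simp
    then have i: "i + 2 < n" by (simp add: i_def)
    have "a = rim n k ! i" "y = rim n k ! (i + 2)"
      by (simp_all add: p i_def nth_append)
    moreover have "(k + (i + 2)) mod n = ((k + i) mod n + 2) mod n"
      by (metis mod_add_left_eq add.assoc)
    ultimately show ?thesis
      using i skip_in_E2[OF assms(1), of "(k + i) mod n"] by (simp add: nth_rim)
  qed
  show ?thesis
    using assms(2)
  proof
    assume "p = rim n k"
    then show ?thesis using * assms(3) by metis
  next
    assume "p = rev (rim n k)"
    then have "rim n k = rev (as @ a # x # y # cs)" using assms(3) by (metis rev_rev_ident)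
    then have "rim n k = rev cs @ y # x # a # rev as" by simp
    then show ?thesis using * by (metis insert_commute)
  qed
qed

lemma rim_inj:
  assumes "k < n" "j < n" "rim n k = rim n j"
  shows "k = j"
proof -
  have "rim n i ! 0 = i + 1" if "i < n" for i
    using that by (simp add: nth_rim)
  from this[OF assms(1)] this[OF assms(2)] show ?thesis
    unfolding assms(3) by simp
qed

text \<open>Rim paths step by 1 modulo \<open>n\<close> and their reversals by -1. Comparing the
  first two entries would give \<open>n dvd n - 2\<close>, impossible for
  \<open>n \<ge> 3\<close>.\<close>

lemma rim_neq_rev_rim:
  assumes "k < n" "j < n" "n \<ge> 3"
  shows "rim n k \<noteq> rev (rim n j)"
proof
  assume eq: "rim n k = rev (rim n j)"
  have "rim n k ! i = rim n j ! (n - 1 - i)" if "i < n" for i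
    using that by (simp add: eq rev_nth)
  from this[of 0] this[of 1] have "k mod n = (j + (n - 1)) mod n" "(k + 1) mod n = (j + (n - 2)) mod n"
    using assms by (auto simp: nth_rim numeral_2_eq_2)
  then have "(k + 1) mod n = (j + (n - 1) + 1) mod n"
    by (metis mod_add_left_eq)
  also have "\<dots> = j mod n"
    using assms by (simp add: add.assoc)
  finally have "(j + (n - 2)) mod n = j mod n"
    using \<open>(k + 1) mod n = (j + (n - 2)) mod n\<close> by simp
  then have "n dvd n - 2"
    using mod_eq_dvd_iff_nat[of j "j + (n - 2)" n] by simp
  then show False
    using assms by (auto dest: dvd_imp_le)
qed


section \<open>Partial routes\<close>

text \<open>Connects the indexed sets of \<open>partial_route\<close> and
  \<open>pr_customers\<close> with the list form used in \<open>adheres\<close>.\<close>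

lemma set_butlast_tl: "set (butlast (tl h)) = (!) h ` {1..length h - 2}"
proof -
  have "set (butlast (tl h)) = (!) (butlast (tl h)) ` {..<length h - 2}"
    by (auto simp: set_conv_nth)
  also have "\<dots> = (\<lambda>i. h ! Suc i) ` {..<length h - 2}"
    by (intro image_cong) (simp_all add: nth_butlast nth_tl)
  also have "\<dots> = (!) h ` (Suc ` {..<length h - 2})"
    by (simp add: image_image)
  also have "Suc ` {..<length h - 2} = {1..length h - 2}"
    by (simp add: lessThan_atLeast0 image_Suc_atLeastLessThan atLeastLessThanSuc_atLeastAtMost)
  finally show ?thesis .
qed

lemma pr_customers_subset:
  assumes "partial_route n h"
  shows "pr_customers h \<subseteq> customers n" "pr_customers h \<noteq> {}"
proof -
  have "length h - 1 \<ge> 2"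
    using assms unfolding partial_route_def Let_def by blast
  then have "{1..length h - 2} \<noteq> {}"
    by simp
  moreover have "length h - 1 - 1 = length h - 2"
    by simp
  then have "\<forall>j\<in>{1..length h - 2}. h ! j \<noteq> {} \<and> h ! j \<subseteq> customers n"
    using assms unfolding partial_route_def Let_def by metis
  ultimately show "pr_customers h \<subseteq> customers n" "pr_customers h \<noteq> {}"
    unfolding pr_customers_def by blast+
qed

text \<open>If two customers \<open>x\<close>, \<open>y\<close> shared a set of \<open>h\<close>, they could be exchanged, at the price of an edge of \<open>E2\<close>.\<close>

lemma rim_adheres_unique:
  assumes n: "n \<ge> 4" and \<mu>: "0 < \<mu>" "\<mu> < 1"
    and h: "partial_route n h" "recourse_bound n \<mu> h P" "P > 0"
    and p: "p = rim n k \<or> p = rev (rim n k)" "adheres h p"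
  shows "p = map the_elem (butlast (tl h))"
proof -
  have dp: "distinct p" "set p = customers n" using p(1) by auto
  obtain bs where bs: "p = concat bs" "map set bs = butlast (tl h)"
    using p(2) by (auto simp: adheres_def)
  have "\<exists>x. b = [x]" if b_in: "b \<in> set bs" for b
  proof -
    have "set b \<in> set (butlast (tl h))"
      using b_in by (simp flip: bs(2))
    then obtain i where "i \<in> {1..length h - 2}" "set b = h ! i"
      unfolding set_butlast_tl by blast
    then have "set b \<noteq> {}"
      using h(1) by (auto simp: partial_route_def Let_def numeral_2_eq_2)
    then obtain x b' where b: "b = x # b'" by (cases b) auto
    show ?thesis
    proof (cases b')
      case Nil
      then show ?thesis using b by simp
    next
      case (Cons y c)
      obtain bs1 bs2 where split: "bs = bs1 @ b # bs2"
        using split_list[OF b_in] by blast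
      define as where "as = concat bs1"
      define cs where "cs = c @ concat bs2"
      define p' where "p' = as @ y # x # cs"
      have p_eq: "p = as @ x # y # cs"
        by (simp add: bs(1) split b Cons as_def cs_def)
      have dp': "distinct p'" "set p' = customers n"
        using dp by (auto simp: p'_def p_eq)
      have "p' = concat (bs1 @ (y # x # c) # bs2)"
        by (simp add: p'_def as_def cs_def)
      moreover have "map set (bs1 @ (y # x # c) # bs2) = butlast (tl h)"
        by (simp add: b Cons split insert_commute flip: bs(2))
      moreover have "set p' = pr_customers h"
        using p(2) dp(2) dp'(2) by (simp add: adheres_def)
      ultimately have "adheres h p'"
        unfolding adheres_def by blast
      then have "p' \<in> R n h"
        using dp' by (auto simp: R_def cust_path_def p'_def)
      then have "P \<le> OR_recourse n \<mu> p'"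
        using h(2) by (simp add: recourse_bound_def)
      \<comment> \<open>The edge of \<open>E2\<close> is \<open>{a, y}\<close> if some
        \<open>a\<close> precedes the swapped pair, and otherwise \<open>{x, z}\<close> for the
        customer \<open>z\<close> after it, which exists since \<open>n \<ge> 4\<close>.\<close>
      moreover have "OR_recourse n \<mu> p' = 0"
      proof (cases as rule: rev_cases)
        case (snoc as' a)
        then have "{a, y} \<in> E2 n"
          using p_eq by (intro rim_skip_in_E2[OF n p(1), of as' a x y cs]) simp
        then show ?thesis
          using n snoc by (intro OR_recourse_eq_0_if_E2[OF _ \<mu> dp', of as' a y "x # cs"])
            (auto simp: p'_def)
      next
        case Nil
        moreover have "length p = n" by (rule length_route[OF dp])
        ultimately obtain z cs' where cs: "cs = z # cs'"
          using n p_eq by (cases cs) auto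
        then have "{x, z} \<in> E2 n"
          using p_eq by (intro rim_skip_in_E2[OF n p(1), of as x y z cs']) simp
        then show ?thesis
          using n cs by (intro OR_recourse_eq_0_if_E2[OF _ \<mu> dp', of "as @ [y]" x z cs'])
            (auto simp: p'_def)
      qed
      ultimately show ?thesis using h(3) by simp
    qed
  qed
  \<comment> \<open>As all blocks are singletons, \<open>the_elem\<close> reads \<open>p\<close> off
    \<open>h\<close> alone.\<close>
  then have "concat bs = map the_elem (map set bs)"
    by (induction bs) force+
  then show ?thesis by (simp add: bs)
qed

text \<open>One orientation of each of the two routes is the list determined by \<open>h\<close>, so
  they agree up to reversal; no rim path is the reversal of a rim path.\<close>

lemma rim_in_R_unique:
  assumes n: "n \<ge> 4" and \<mu>: "0 < \<mu>" "\<mu> < 1"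
    and h: "partial_route n h" "recourse_bound n \<mu> h P" "P > 0"
    and "k < n" "j < n" "rim n k \<in> R n h" "rim n j \<in> R n h"
  shows "k = j"
proof -
  have "rim n i = map the_elem (butlast (tl h)) \<or> rev (rim n i) = map the_elem (butlast (tl h))"
    if "rim n i \<in> R n h" for i
    using that rim_adheres_unique[OF n \<mu> h] unfolding R_def by blast
  from this[OF assms(9)] this[OF assms(10)]
  consider "rim n k = rim n j" | "rim n k = rev (rim n j)" | "rim n j = rev (rim n k)"
    by (metis rev_rev_ident)
  then show ?thesis
    using rim_inj[of k n j] rim_neq_rev_rim[of k n j] rim_neq_rev_rim[of j n k] assms(1,7,8)
    by cases auto
qed

section \<open>Counting inequalities against rim routes\<close>

lemma inequality_cuts_off_unique_rim:
  fixes \<theta> :: "nat \<Rightarrow> real"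
  assumes n: "n \<ge> 4" and \<mu>: "0 < \<mu>" "\<mu> < 1"
    and routes: "\<And>k. rim n k \<in> feasible_routes n \<mu> f"
    and I: "partial_route_based n \<mu> f I"
    and \<theta>: "\<theta> \<in> thetas n" "\<And>i. i \<in> customers n \<Longrightarrow> \<theta> i = 0"
    and k: "k < n" "\<not> I (edge_vec (rim n k)) \<theta>"
    and j: "j < n" "\<not> I (edge_vec (rim n j)) \<theta>"
  shows "k = j"
proof -
  \<comment> \<open>At zero \<open>\<theta>\<close> a violation means \<open>P * W > 0\<close>.
    Since \<open>P \<ge> 0\<close>, both factors are positive, while an activation function is
    nonpositive off \<open>R n h\<close>.\<close>
  have cut: "P > 0 \<and> rim n i \<in> R n h"
    if "activation n \<mu> f h W" "recourse_bound n \<mu> h P" "\<not> P * W (edge_vec (rim n i)) \<le> 0"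
    for h W P i
  proof -
    have "P \<noteq> 0" "P \<ge> 0"
      using that by (auto simp: recourse_bound_def)
    moreover from this have "\<not> W (edge_vec (rim n i)) \<le> 0"
      using that(3) by (auto simp: mult_le_0_iff)
    ultimately show ?thesis
      using that(1) routes[of i] by (auto simp: activation_def)
  qed
  from I k j show ?thesis
  proof cases
    case (partial_route_split h W P)
    have "finite (pr_customers h)"
      using pr_customers_subset(1)[OF partial_route_split(2)]
      by (rule finite_subset) (simp add: customers_def)
    then have "Min (pr_customers h) \<in> customers n"
      using pr_customers_subset[OF partial_route_split(2)] Min_in by blast
    then have "\<theta> (Min (pr_customers h)) = 0" by (rule \<theta>(2))
    then show ?thesis
      using cut[OF partial_route_split(3,4)] k j partial_route_split
        rim_in_R_unique[OF n \<mu> partial_route_split(2,4)] by auto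
  next
    case (all_customers h W P)
    then show ?thesis
      using cut[OF all_customers(4,5)] k j rim_in_R_unique[OF n \<mu> all_customers(2,5)]
      by (auto simp: \<theta>(2))
  next
    case inactive
    then show ?thesis using k(2) routes \<theta>(1) by (auto simp: feasible_def)
  qed
qed

theorem theorem8:
  fixes n :: nat and \<mu> f :: real and C :: "ineq set"
  assumes "n \<ge> 4"
    and "0 < \<mu>" and "\<mu> < 1"
    and "f \<ge> real n * \<mu> / of_int (capacity n)"
    and "finite C" and "card C < n"
    and "\<forall>I\<in>C. partial_route_based n \<mu> f I"
  shows "RMP_value n \<mu> f C < Z_star n \<mu> f"
proof -
  \<comment> \<open>The zero vector is restricted to the customers because \<open>thetas\<close>
    consists of extensional functions.\<close>
  define \<theta> where "\<theta> = (\<lambda>i\<in>customers n. 0 :: real)"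
  have \<theta>: "\<theta> \<in> thetas n" "\<And>i. i \<in> customers n \<Longrightarrow> \<theta> i = 0"
    by (auto simp: \<theta>_def thetas_def)
  have routes: "rim n k \<in> feasible_routes n \<mu> f" for k
    using assms(1,4) by (subst feasible_routes_eq) auto
  have "\<exists>k<n. \<forall>I\<in>C. I (edge_vec (rim n k)) \<theta>"
  proof (rule ccontr)
    assume "\<not> ?thesis"
    then obtain g where g: "\<And>k. k < n \<Longrightarrow> g k \<in> C \<and> \<not> g k (edge_vec (rim n k)) \<theta>"
      by metis
    \<comment> \<open>Pigeonhole: \<open>g\<close> assigns to each rim route an inequality that cuts
      it off, and no inequality serves two routes.\<close>
    have "inj_on g {..<n}"
    proof (rule inj_onI)
      fix k j assume kj: "k \<in> {..<n}" "j \<in> {..<n}" "g k = g j"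
      show "k = j"
        by (rule inequality_cuts_off_unique_rim[OF assms(1-3) routes _ \<theta>, of "g k"])
           (use kj g[of k] g[of j] assms(7) in auto)
    qed
    then have "n \<le> card C"
      using card_inj_on_le[of g "{..<n}" C] g assms(5) by auto
    then show False using assms(6) by simp
  qed
  then obtain k where k: "\<forall>I\<in>C. I (edge_vec (rim n k)) \<theta>" by blast
  have "real (n + 1) = routing_cost n (edge_vec (rim n k)) + (\<Sum>i\<in>customers n. \<theta> i)"
    using routing_cost_no_E2[OF _ _ _ rim_no_E2] assms(1) by (simp add: \<theta>(2))
  moreover have "edge_vec (rim n k) \<in> feasible n \<mu> f"
    using routes by (simp add: feasible_def)
  ultimately have "real (n + 1) \<in> RMP_objectives n \<mu> f C"
    using \<theta>(1) k unfolding RMP_objectives_def by blast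
  then have "RMP_value n \<mu> f C \<le> n + 1"
    unfolding RMP_value_def using bdd_below_RMP_objectives by (rule cInf_lower)
  also have "\<dots> < Z_star n \<mu> f"
    using assms by (intro Z_star_gt) auto
  finally show ?thesis .
qed

end
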